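(* Let $T$ be a finite tree. Then $T$ is $\mathbb{Z}_2^2$-cordial if and only if $T$ is not isomorphic to $P_4$ or $P_5$. Equivalently: every finite tree other than $P_4$ and $P_5$ is $\mathbb{Z}_2^2$-cordial (and $P_4$, $P_5$ are not).
   Context: Graphs are finite, simple and undirected. $\mathbb{Z}_2^2=\mathbb{Z}_2\times\mathbb{Z}_2$ is the Klein four-group. For an abelian group $A$ and a graph $G=(V,E)$, a vertex labeling $\ell:V\to A$ induces an edge labeling $\ell(\{v_1,v_2\})=\ell(v_1)+\ell(v_2)$. Let $f_V(a)=|\{v\in V:\ell(v)=a\}|$ and $f_E(a)=|\{e\in E:\ell(e)=a\}|$. The labeling is $A$-cordial if $|f_V(a_1)-f_V(a_2)|\le 1$ and $|f_E(a_1)-f_E(a_2)|\le 1$ for all $a_1,a_2\in A$; $G$ is $A$-cordial if it admits an $A$-cordial labeling. $P_n$ denotes the path on $n$ vertices. *)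

theory Defs
  imports Main "HOL-Library.Z2" "HOL-Library.Product_Plus"
begin

definition simple_graph :: "'a set \<Rightarrow> 'a set set \<Rightarrow> bool" where
  "simple_graph V E \<longleftrightarrow> finite V \<and> (\<forall>e\<in>E. \<exists>u v. e = {u, v} \<and> u \<noteq> v \<and> u \<in> V \<and> v \<in> V)"

definition adj :: "'a set set \<Rightarrow> 'a \<Rightarrow> 'a \<Rightarrow> bool" where
  "adj E u v \<longleftrightarrow> {u, v} \<in> E \<and> u \<noteq> v"

definition connected_graph :: "'a set \<Rightarrow> 'a set set \<Rightarrow> bool" where
  "connected_graph V E \<longleftrightarrow> V \<noteq> {} \<and> (\<forall>u\<in>V. \<forall>v\<in>V. (adj E)\<^sup>*\<^sup>* u v)"

definition is_cycle :: "'a set set \<Rightarrow> 'a list \<Rightarrow> bool" where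
  "is_cycle E cs \<longleftrightarrow> length cs \<ge> 3 \<and> distinct cs
     \<and> (\<forall>i. Suc i < length cs \<longrightarrow> adj E (cs ! i) (cs ! Suc i))
     \<and> adj E (last cs) (hd cs)"

definition acyclic_graph :: "'a set set \<Rightarrow> bool" where
  "acyclic_graph E \<longleftrightarrow> \<not> (\<exists>cs. is_cycle E cs)"

definition is_tree :: "'a set \<Rightarrow> 'a set set \<Rightarrow> bool" where
  "is_tree V E \<longleftrightarrow> simple_graph V E \<and> connected_graph V E \<and> acyclic_graph E"

definition graph_iso :: "'a set \<Rightarrow> 'a set set \<Rightarrow> 'b set \<Rightarrow> 'b set set \<Rightarrow> bool" where
  "graph_iso V E W F \<longleftrightarrow> (\<exists>f. bij_betw f V W \<and>
      (\<forall>u\<in>V. \<forall>v\<in>V. {u, v} \<in> E \<longleftrightarrow> {f u, f v} \<in> F))"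

definition path_V :: "nat \<Rightarrow> nat set" where
  "path_V n = {0..<n}"

definition path_E :: "nat \<Rightarrow> nat set set" where
  "path_E n = {{i, Suc i} | i. Suc i < n}"

definition fV :: "'a set \<Rightarrow> ('a \<Rightarrow> 'b) \<Rightarrow> 'b \<Rightarrow> nat" where
  "fV V l a = card {v\<in>V. l v = a}"

definition fE :: "'a set set \<Rightarrow> ('a \<Rightarrow> 'b::ab_group_add) \<Rightarrow> 'b \<Rightarrow> nat" where
  "fE E l a = card {e\<in>E. \<exists>u v. e = {u, v} \<and> u \<noteq> v \<and> l u + l v = a}"

definition cordial_labeling :: "'a set \<Rightarrow> 'a set set \<Rightarrow> ('a \<Rightarrow> 'b::ab_group_add) \<Rightarrow> bool" where
  "cordial_labeling V E l \<longleftrightarrow>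
     (\<forall>a1 a2. \<bar>int (fV V l a1) - int (fV V l a2)\<bar> \<le> 1) \<and>
     (\<forall>a1 a2. \<bar>int (fE E l a1) - int (fE E l a2)\<bar> \<le> 1)"

definition cordial :: "'b::ab_group_add itself \<Rightarrow> 'a set \<Rightarrow> 'a set set \<Rightarrow> bool" where
  "cordial _ V E \<longleftrightarrow> (\<exists>l :: 'a \<Rightarrow> 'b. cordial_labeling V E l)"

type_synonym klein4 = "bit \<times> bit"

end

theory Submission
  imports Defs
begin

text \<open>
  A tree with \<open>n\<close> vertices that has a cordial labeling keeps one when a leaf is attached, greedily,
  unless \<open>n + 1\<close> is divisible by 4. So the crux is \<open>n = 4 * q\<close>. A tree with a vertex of degree at least
  3 has three leaves; remove these and then one more leaf. Whatever the four parents are, a labeling of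
  the remaining tree extends to the four vertices so that they receive distinct labels and the edge
  counts stay balanced (a finite check over the parent labels). This descends to \<open>n = 8\<close>, where the
  tree grows from the star with three leaves and again finitely many cases remain; the descent cannot
  continue to \<open>n = 4\<close> because it could reach the path with four vertices. Paths are
  lengthened by four vertices at one end, starting from eight.
\<close>

subsection \<open>Growing trees by leaves\<close>

text \<open>Growth starts from an arbitrary graph rather than from a point, so that a chosen
  subtree, such as a star, survives when leaves are taken off again.\<close>

inductive grown :: "'a set \<Rightarrow> 'a set set \<Rightarrow> 'a set \<Rightarrow> 'a set set \<Rightarrow> bool" for S F where
  base: "grown S F S F"
| leaf: "grown S F V E \<Longrightarrow> v \<notin> V \<Longrightarrow> u \<in> V \<Longrightarrow> grown S F (insert v V) (insert {u, v} E)"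

lemma grown_trans: "grown T G V E \<Longrightarrow> grown S F T G \<Longrightarrow> grown S F V E"
  by (induction rule: grown.induct) (auto intro: grown.leaf)

lemma simple_graph_finite: "simple_graph V E \<Longrightarrow> finite V"
  by (simp add: simple_graph_def)

lemma simple_graph_subset: "simple_graph V E \<Longrightarrow> e \<in> E \<Longrightarrow> e \<subseteq> V"
  by (auto simp: simple_graph_def)

lemma simple_graph_finite_edges: "simple_graph V E \<Longrightarrow> finite E"
  by (rule finite_subset[of _ "Pow V"]) (auto simp: simple_graph_finite dest: simple_graph_subset)

lemma simple_graph_leaf:
  assumes "simple_graph V E" "v \<notin> V" "u \<in> V"
  shows "simple_graph (insert v V) (insert {u, v} E)"
  using assms unfolding simple_graph_def by (fastforce intro: exI[of _ u] exI[of _ v])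

lemma simple_graph_grown: "grown S F V E \<Longrightarrow> simple_graph S F \<Longrightarrow> simple_graph V E"
  by (induction rule: grown.induct) (simp_all add: simple_graph_leaf)

lemma grown_subset: "grown S F V E \<Longrightarrow> S \<subseteq> V \<and> F \<subseteq> E"
  by (induction rule: grown.induct) auto

lemma grown_card:
  "grown S F V E \<Longrightarrow> simple_graph S F \<Longrightarrow> card V + card F = card E + card S"
proof (induction rule: grown.induct)
  case (leaf V E v u)
  then have "simple_graph V E" by (blast intro: simple_graph_grown)
  moreover from this have "{u, v} \<notin> E" using leaf.hyps simple_graph_subset by fastforce
  ultimately show ?case
    using leaf by (simp add: simple_graph_finite simple_graph_finite_edges)
qed simp

lemma adj_sym: "adj E u v \<Longrightarrow> adj E v u"
  by (auto simp: adj_def insert_commute)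

lemma adj_rtranclp_sym: "(adj E)\<^sup>*\<^sup>* u v \<Longrightarrow> (adj E)\<^sup>*\<^sup>* v u"
  by (induction rule: rtranclp_induct) (auto dest: adj_sym intro: converse_rtranclp_into_rtranclp)

lemma adj_rtranclp_mono: "F \<subseteq> E \<Longrightarrow> (adj F)\<^sup>*\<^sup>* u v \<Longrightarrow> (adj E)\<^sup>*\<^sup>* u v"
  by (rule rtranclp_mono[THEN predicate2D, of "adj F"]) (auto simp: adj_def)

lemma connected_graphI:
  assumes "r \<in> V" "\<And>v. v \<in> V \<Longrightarrow> (adj E)\<^sup>*\<^sup>* r v"
  shows "connected_graph V E"
  using assms unfolding connected_graph_def by (meson adj_rtranclp_sym empty_iff rtranclp_trans)

lemma connected_graph_grown:
  "grown S F V E \<Longrightarrow> connected_graph S F \<Longrightarrow> connected_graph V E"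
proof (induction rule: grown.induct)
  case (leaf V E v u)
  let ?E = "insert {u, v} E"
  have conn: "connected_graph V E" using leaf by blast
  have "(adj ?E)\<^sup>*\<^sup>* u w" if "w \<in> insert v V" for w
  proof (cases "w = v")
    case True
    have "adj ?E u v" using leaf.hyps by (auto simp: adj_def)
    then show ?thesis using True by blast
  next
    case False
    then have "(adj E)\<^sup>*\<^sup>* u w"
      using conn that leaf.hyps by (auto simp: connected_graph_def)
    then show ?thesis by (rule adj_rtranclp_mono[rotated]) auto
  qed
  then show ?case using leaf.hyps by (intro connected_graphI[of u]) auto
qed

section \<open>Trees as graphs grown from a single vertex\<close>

lemma rtranclp_crossing:
  "r\<^sup>*\<^sup>* x y \<Longrightarrow> x \<in> S \<Longrightarrow> y \<notin> S \<Longrightarrow> \<exists>u\<in>S. \<exists>v. v \<notin> S \<and> r u v"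
  by (induction rule: rtranclp_induct) blast+

text \<open>Take a maximal vertex set that can be grown inside \<open>E\<close>. If it missed a
  vertex, a walk from \<open>S\<close> to that vertex would cross its boundary, and the crossing
  edge would attach one more leaf.\<close>

lemma grown_spanning:
  assumes simple: "simple_graph V E" and conn: "connected_graph V E"
    and sub: "S \<noteq> {}" "S \<subseteq> V" "F \<subseteq> E"
  obtains F' where "F' \<subseteq> E" "grown S F V F'"
proof -
  define M where "M = {T. T \<subseteq> V \<and> (\<exists>F'\<subseteq>E. grown S F T F')}"
  have "finite M"
    unfolding M_def by (rule finite_subset[of _ "Pow V"]) (auto simp: simple_graph_finite[OF simple])
  moreover have "S \<in> M" using sub by (auto simp: M_def intro: grown.base)
  ultimately obtain T where T: "T \<in> M" and max: "\<And>T'. T' \<in> M \<Longrightarrow> T \<subseteq> T' \<Longrightarrow> T = T'"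
    by (metis empty_iff finite_has_maximal)
  then obtain F' where F': "T \<subseteq> V" "F' \<subseteq> E" "grown S F T F'" by (auto simp: M_def)
  have "T = V"
  proof (rule ccontr)
    assume "T \<noteq> V"
    then obtain y where y: "y \<in> V" "y \<notin> T" using F' by blast
    obtain x where x: "x \<in> S" using sub by blast
    have "(adj E)\<^sup>*\<^sup>* x y" using conn x y sub by (auto simp: connected_graph_def)
    moreover have "x \<in> T" using x grown_subset[OF F'(3)] by blast
    ultimately obtain u v where uv: "u \<in> T" "v \<notin> T" "adj E u v"
      using rtranclp_crossing[of "adj E" x y T] y by blast
    then have "{u, v} \<in> E" by (simp add: adj_def)
    moreover have "grown S F (insert v T) (insert {u, v} F')" using F' uv by (blast intro: grown.leaf)
    moreover have "v \<in> V" using simple_graph_subset[OF simple \<open>{u, v} \<in> E\<close>] by simp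
    moreover have "insert {u, v} F' \<subseteq> E" "insert v T \<subseteq> V"
      using F' \<open>{u, v} \<in> E\<close> \<open>v \<in> V\<close> by auto
    ultimately have "insert v T \<in> M" unfolding M_def mem_Collect_eq by blast
    then show False using max[of "insert v T"] uv by blast
  qed
  then show thesis using that F' by blast
qed

text \<open>When the vertex put in front already lies on the walk, everything before that occurrence
  is cut off.\<close>

lemma rtranclp_distinct_walk:
  assumes "r\<^sup>*\<^sup>* x y"
  obtains xs where "xs \<noteq> []" "hd xs = x" "last xs = y" "distinct xs" "successively r xs"
  using assms
proof (induction arbitrary: thesis rule: converse_rtranclp_induct)
  case base
  show ?case by (rule base[of "[y]"]) auto
next
  case (step x z)
  obtain xs where xs: "xs \<noteq> []" "hd xs = z" "last xs = y" "distinct xs" "successively r xs"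
    using step.IH by blast
  show ?case
  proof (cases "x \<in> set xs")
    case True
    then obtain as bs where "xs = as @ x # bs" by (meson split_list)
    then show ?thesis using xs by (intro step.prems[of "x # bs"]) (auto simp: successively_append_iff)
  next
    case False
    then show ?thesis using xs step.hyps
      by (intro step.prems[of "x # xs"]) (auto simp: successively_Cons)
  qed
qed

text \<open>If \<open>F\<close> lacked an edge of the tree, a walk in \<open>F\<close> between the
  ends of that edge would close to a cycle.\<close>

lemma tree_edges_minimal:
  assumes tree: "is_tree V E" and sub: "F \<subseteq> E" and conn: "connected_graph V F"
  shows "F = E"
proof (rule ccontr)
  assume "F \<noteq> E"
  then obtain e where "e \<in> E" "e \<notin> F" using sub by blast
  moreover from this obtain u v where uv: "e = {u, v}" "u \<noteq> v" "u \<in> V" "v \<in> V"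
    using tree unfolding is_tree_def simple_graph_def by meson
  ultimately have e: "{u, v} \<in> E" "{u, v} \<notin> F" by auto
  have "(adj F)\<^sup>*\<^sup>* u v" using conn uv by (auto simp: connected_graph_def)
  then obtain xs where xs: "xs \<noteq> []" "hd xs = u" "last xs = v" "distinct xs" "successively (adj F) xs"
    by (rule rtranclp_distinct_walk)
  \<comment> \<open>One vertex is impossible because the ends differ, two because the edge between
    them is the one that \<open>F\<close> lacks.\<close>
  have "length xs \<ge> 3"
  proof (rule ccontr)
    assume "\<not> length xs \<ge> 3"
    then consider "length xs = 0" | "length xs = 1" | "length xs = 2" by linarith
    then show False
      using xs uv e by cases (auto simp: length_Suc_conv numeral_2_eq_2 adj_def)
  qed
  moreover have "adj E (xs ! i) (xs ! Suc i)" if "Suc i < length xs" for i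
    using xs(5) that sub by (auto simp: successively_conv_nth adj_def)
  ultimately have "is_cycle E xs"
    using xs e uv by (auto simp: is_cycle_def adj_def insert_commute)
  then show False using tree by (auto simp: is_tree_def acyclic_graph_def)
qed

text \<open>This is the working notion of a tree: it comes with an induction by leaves, and no
  cycles have to be handled.\<close>

definition built :: "'a set \<Rightarrow> 'a set set \<Rightarrow> bool" where
  "built V E \<longleftrightarrow> (\<exists>r. grown {r} {} V E)"

lemma singleton_graph: "simple_graph {r} {}" "connected_graph {r} {}"
  by (auto simp: simple_graph_def connected_graph_def)

lemma built_leaf: "built V E \<Longrightarrow> v \<notin> V \<Longrightarrow> u \<in> V \<Longrightarrow> built (insert v V) (insert {u, v} E)"
  by (auto simp: built_def intro: grown.leaf)

lemma built_simple: "built V E \<Longrightarrow> simple_graph V E"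
  and built_connected: "built V E \<Longrightarrow> connected_graph V E"
  by (auto simp: built_def singleton_graph intro: simple_graph_grown connected_graph_grown)

lemma built_card: "built V E \<Longrightarrow> card V = Suc (card E)"
  using grown_card by (fastforce simp: built_def singleton_graph)

lemma tree_built:
  assumes tree: "is_tree V E"
  shows "built V E"
proof -
  obtain r where r: "r \<in> V" using tree by (auto simp: is_tree_def connected_graph_def)
  obtain F where F: "F \<subseteq> E" "grown {r} {} V F"
    by (rule grown_spanning[of V E "{r}" "{}"]) (use tree r in \<open>auto simp: is_tree_def\<close>)
  have "F = E"
    using tree_edges_minimal[OF tree F(1)] connected_graph_grown[OF F(2)] by (simp add: singleton_graph)
  then show ?thesis using F by (auto simp: built_def)
qed

text \<open>The order of growth may start at any subtree. Spanning growth gives some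
  \<open>F'\<close> inside \<open>E\<close>; both have one edge fewer than there are vertices, so
  they coincide.\<close>

lemma built_grown:
  assumes built: "built V E" and sub: "built S F" "S \<subseteq> V" "F \<subseteq> E"
  shows "grown S F V E"
proof -
  obtain F' where F': "F' \<subseteq> E" "grown S F V F'"
  proof (rule grown_spanning)
    show "simple_graph V E" "connected_graph V E"
      using built by (simp_all add: built_simple built_connected)
    show "S \<noteq> {}" using built_connected[OF sub(1)] by (simp add: connected_graph_def)
  qed (use sub in auto)
  have "card V = Suc (card F')"
    using grown_card[OF F'(2)] built_simple built_card sub(1) by fastforce
  then have "F' = E"
    using built_card[OF built] F'(1) simple_graph_finite_edges[OF built_simple[OF built]]
    by (simp add: card_subset_eq)
  then show ?thesis using F' by blast
qed

section \<open>Trees with a vertex of degree at least three\<close>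

text \<open>The degree condition at \<open>c\<close> is encoded as growth from a star with three
  leaves. The leaf added last can then be removed without destroying the star.\<close>

definition branching :: "'a set \<Rightarrow> 'a set set \<Rightarrow> bool" where
  "branching V E \<longleftrightarrow>
    (\<exists>c x y z. distinct [c, x, y, z] \<and> grown {z, y, x, c} {{c, z}, {c, y}, {c, x}} V E)"

lemma star_built:
  assumes "distinct [c, x, y, z]"
  shows "built {z, y, x, c} {{c, z}, {c, y}, {c, x}}"
proof -
  have "built {c} {}" by (auto simp: built_def intro: grown.base)
  then show ?thesis using assms by (intro built_leaf) auto
qed

lemma branching_built: "branching V E \<Longrightarrow> built V E"
  unfolding branching_def using star_built unfolding built_def by (meson grown_trans)

lemma branching_leaf:
  "branching V E \<Longrightarrow> v \<notin> V \<Longrightarrow> u \<in> V \<Longrightarrow> branching (insert v V) (insert {u, v} E)"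
  unfolding branching_def by (meson grown.leaf)

lemma built_branching:
  assumes "built V E" "distinct [c, x, y, z]" "{c, x} \<in> E" "{c, y} \<in> E" "{c, z} \<in> E"
  shows "branching V E"
proof -
  have "grown {z, y, x, c} {{c, z}, {c, y}, {c, x}} V E"
    using assms simple_graph_subset[OF built_simple[OF assms(1)]]
    by (intro built_grown star_built) auto
  then show ?thesis using assms(2) unfolding branching_def by blast
qed

lemma grown_cases_leaf:
  assumes "grown S F V E" "card V \<noteq> card S"
  obtains V' E' u v where "grown S F V' E'" "u \<in> V'" "v \<notin> V'" "V = insert v V'" "E = insert {u, v} E'"
  using assms by (cases rule: grown.cases) auto

lemma branching_remove_leaf:
  assumes "branching V E" "card V \<noteq> 4"
  obtains V' E' u v where "branching V' E'" "u \<in> V'" "v \<notin> V'" "V = insert v V'" "E = insert {u, v} E'"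
proof -
  obtain c x y z where *: "distinct [c, x, y, z]" "grown {z, y, x, c} {{c, z}, {c, y}, {c, x}} V E"
    using assms by (auto simp: branching_def)
  have "card {z, y, x, c} = 4" using *(1) by auto
  then show thesis using grown_cases_leaf[OF *(2)] assms(2) *(1) that unfolding branching_def by metis
qed

lemma built_remove_leaf:
  assumes "built V E" "card V \<noteq> 1"
  obtains V' E' u v where "built V' E'" "u \<in> V'" "v \<notin> V'" "V = insert v V'" "E = insert {u, v} E'"
proof -
  obtain r where *: "grown {r} {} V E"
    using assms by (auto simp: built_def)
  then show thesis using grown_cases_leaf[OF *] assms(2) that unfolding built_def
    by (metis card.empty card_insert_if empty_iff finite.emptyI One_nat_def)
qed

text \<open>Three leaves are maintained along the growth from the star. A new leaf replaces its
  parent if that was one of the three, and otherwise an arbitrary one of them; the replaced vertex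
  moves into \<open>W\<close>.\<close>

lemma branching_three_leaves:
  assumes "branching V E"
  shows "\<exists>W F x y z px py pz. built W F \<and> distinct [x, y, z] \<and> W \<inter> {x, y, z} = {} \<and>
    {px, py, pz} \<subseteq> W \<and> V = insert z (insert y (insert x W)) \<and>
    E = insert {pz, z} (insert {py, y} (insert {px, x} F))"
proof -
  define P where "P V E \<longleftrightarrow> (\<exists>W F x y z px py pz. built W F \<and> distinct [x, y, z] \<and> W \<inter> {x, y, z} = {} \<and>
    {px, py, pz} \<subseteq> W \<and> V = insert z (insert y (insert x W)) \<and>
    E = insert {pz, z} (insert {py, y} (insert {px, x} F)))" for V :: "'a set" and E
  have PI: "P V E" if "built W F" "distinct [x, y, z]" "W \<inter> {x, y, z} = {}"
      "{px, py, pz} \<subseteq> W" "V = insert z (insert y (insert x W))"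
      "E = insert {pz, z} (insert {py, y} (insert {px, x} F))" for V :: "'a set" and E W F x y z px py pz
    unfolding P_def using that by blast
  obtain c x y z where *: "distinct [c, x, y, z]" "grown {z, y, x, c} {{c, z}, {c, y}, {c, x}} V E"
    using assms by (auto simp: branching_def)
  from *(2) have "P V E"
  proof (induction rule: grown.induct)
    case base
    have "built {c} {}" by (auto simp: built_def intro: grown.base)
    then show ?case by (rule PI[of "{c}" "{}" x y z c c c, OF _ _ _ _ refl refl]) (use *(1) in auto)
  next
    case (leaf V E v u)
    then obtain W F x y z px py pz where W: "built W F" "distinct [x, y, z]" "W \<inter> {x, y, z} = {}"
      "{px, py, pz} \<subseteq> W" "V = insert z (insert y (insert x W))"
      "E = insert {pz, z} (insert {py, y} (insert {px, x} F))" unfolding P_def by blast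
    \<comment> \<open>Here \<open>x\<close> is the leaf to be replaced, whether \<open>u\<close> is
      \<open>x\<close> or lies in \<open>W\<close>. The cases \<open>u = y\<close> and
      \<open>u = z\<close> follow by exchanging names.\<close>
    have *: ?case if "built W F" "distinct [x, y, z]" "W \<inter> {x, y, z} = {}"
      "{px, py, pz} \<subseteq> W" "V = insert z (insert y (insert x W))"
      "E = insert {pz, z} (insert {py, y} (insert {px, x} F))" "u \<in> insert x W" for W F x y z px py pz
    proof -
      have "built (insert x W) (insert {px, x} F)" using that by (intro built_leaf) auto
      moreover have "distinct [y, z, v]" "insert x W \<inter> {y, z, v} = {}" "{py, pz, u} \<subseteq> insert x W"
        using that leaf.hyps by auto
      moreover have "insert v V = insert v (insert z (insert y (insert x W)))" using that by simp
      moreover have "insert {u, v} E =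
          insert {u, v} (insert {pz, z} (insert {py, y} (insert {px, x} F)))" using that by simp
      ultimately show ?thesis by (rule PI)
    qed
    consider "u \<in> insert x W" | "u = y" | "u = z" using W(5) leaf.hyps by blast
    then show ?case
    proof cases
      case 1
      show ?thesis by (rule *[OF W 1])
    next
      case 2
      show ?thesis by (rule *[of W F y x z py px pz]) (use W 2 in auto)
    next
      case 3
      show ?thesis by (rule *[of W F z y x pz py px]) (use W 3 in auto)
    qed
  qed
  then show ?thesis unfolding P_def .
qed

subsection \<open>Enumerations of trees and paths\<close>

text \<open>The vertex \<open>f (Suc i)\<close> hangs off \<open>f (par i)\<close>; the number of edges is \<open>n\<close>.\<close>

definition enum_tree :: "nat \<Rightarrow> (nat \<Rightarrow> 'a) \<Rightarrow> (nat \<Rightarrow> nat) \<Rightarrow> 'a set \<Rightarrow> 'a set set \<Rightarrow> bool" where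
  "enum_tree n f par V E \<longleftrightarrow> inj_on f {..n} \<and> V = f ` {..n} \<and>
     E = (\<lambda>i. {f (Suc i), f (par i)}) ` {..<n} \<and> (\<forall>i<n. par i \<le> i)"

text \<open>Every vertex hangs off its predecessor. Since \<open>n\<close> counts edges, the
  exceptional paths on 4 and 5 vertices are \<open>path_graph 3\<close> and
  \<open>path_graph 4\<close>.\<close>

definition path_graph :: "nat \<Rightarrow> 'a set \<Rightarrow> 'a set set \<Rightarrow> bool" where
  "path_graph n V E \<longleftrightarrow> (\<exists>f. enum_tree n f (\<lambda>i. i) V E)"

lemma enum_tree_card: "enum_tree n f par V E \<Longrightarrow> card V = Suc n"
  by (auto simp: enum_tree_def card_image)

lemma enum_tree_leaf:
  assumes "enum_tree n f par V E" "v \<notin> V" "j \<le> n"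
  shows "enum_tree (Suc n) (f(Suc n := v)) (par(n := j)) (insert v V) (insert {f j, v} E)"
proof -
  let ?f = "f(Suc n := v)" and ?par = "par(n := j)"
  have "?f ` {..n} = f ` {..n}" by (rule image_cong) auto
  then have "?f ` {..Suc n} = insert v V" using assms by (auto simp: enum_tree_def atMost_Suc)
  moreover have "inj_on ?f {..Suc n}"
    using assms by (auto simp: enum_tree_def inj_on_def)
  moreover have img: "(\<lambda>i. {?f (Suc i), ?f (?par i)}) ` {..<n} = (\<lambda>i. {f (Suc i), f (par i)}) ` {..<n}"
    using assms by (intro image_cong) (auto simp: enum_tree_def)
  have "insert {f j, v} E = (\<lambda>i. {?f (Suc i), ?f (?par i)}) ` {..<Suc n}"
    unfolding lessThan_Suc image_insert img using assms by (auto simp: enum_tree_def insert_commute)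
  ultimately show ?thesis using assms unfolding enum_tree_def by (auto simp: less_Suc_eq)
qed

text \<open>The star is enumerated first, with its center as vertex 0. This fixes three parents and
  keeps the check on eight vertices small.\<close>

lemma branching_enum:
  assumes "branching V E"
  obtains n f par where "enum_tree n f par V E" "par 0 = 0" "par 1 = 0" "par 2 = 0" "n \<ge> 3"
proof -
  obtain c x y z where *: "distinct [c, x, y, z]" "grown {z, y, x, c} {{c, z}, {c, y}, {c, x}} V E"
    using assms by (auto simp: branching_def)
  from *(2) have "\<exists>n f par. enum_tree n f par V E \<and> par 0 = 0 \<and> par 1 = 0 \<and> par 2 = 0 \<and> n \<ge> 3"
  proof (induction rule: grown.induct)
    case base
    have "enum_tree 0 (\<lambda>_. c) (\<lambda>_. 0) {c} {}" by (auto simp: enum_tree_def)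
    then have "enum_tree (Suc (Suc (Suc 0))) ((\<lambda>_. c)(Suc 0 := x, Suc (Suc 0) := y, Suc (Suc (Suc 0)) := z))
      ((\<lambda>_. 0)(0 := 0, Suc 0 := 0, Suc (Suc 0) := 0)) {z, y, x, c} {{c, z}, {c, y}, {c, x}}"
      using *(1) enum_tree_leaf[of 2 "(\<lambda>_. c)(1 := x, 2 := y)" _ _ _ z 0]
        enum_tree_leaf[of 1 "(\<lambda>_. c)(1 := x)" _ _ _ y 0] enum_tree_leaf[of 0 "(\<lambda>_. c)" _ _ _ x 0]
      by (auto simp: numeral_2_eq_2 numeral_3_eq_3)
    then show ?case by (auto simp: eval_nat_numeral intro!: exI)
  next
    case (leaf V E v u)
    then obtain n f par where IH: "enum_tree n f par V E" "par 0 = 0" "par 1 = 0" "par 2 = 0" "n \<ge> 3"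
      by blast
    then obtain j where "j \<le> n" "u = f j" using leaf.hyps by (auto simp: enum_tree_def)
    then have "enum_tree (Suc n) (f(Suc n := v)) (par(n := j)) (insert v V) (insert {u, v} E)"
      using enum_tree_leaf[OF IH(1)] leaf.hyps by blast
    moreover have "(par(n := j)) 0 = 0 \<and> (par(n := j)) 1 = 0 \<and> (par(n := j)) 2 = 0 \<and> Suc n \<ge> 3"
      using IH by auto
    ultimately show ?case by blast
  qed
  then show thesis using that by blast
qed

text \<open>A leaf attached to an end of a path prolongs it; attached to an inner vertex it creates
  a vertex with three neighbours, and such a vertex persists under growth.\<close>

lemma path_or_branching:
  assumes "built V E"
  shows "(\<exists>n. path_graph n V E) \<or> branching V E"
proof -
  obtain r where "grown {r} {} V E" using assms by (auto simp: built_def)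
  then show ?thesis
  proof (induction rule: grown.induct)
    case base
    have "enum_tree 0 (\<lambda>_. r) (\<lambda>i. i) {r} {}" by (auto simp: enum_tree_def)
    then show ?case unfolding path_graph_def by blast
  next
    case (leaf V E v u)
    show ?case
    proof (cases "branching V E")
      case True
      then show ?thesis using leaf.hyps by (intro disjI2 branching_leaf)
    next
      case False
      then obtain n f where f: "enum_tree n f (\<lambda>i. i) V E" using leaf.IH by (auto simp: path_graph_def)
      then have f': "inj_on f {..n}" "V = f ` {..n}" "E = (\<lambda>i. {f (Suc i), f i}) ` {..<n}"
        by (auto simp: enum_tree_def)
      obtain j where j: "j \<le> n" "u = f j" using f' leaf.hyps by auto
      consider "j = n" | "j = 0" | "0 < j" "j < n" using j by linarith
      then show ?thesis
      proof cases
        case 1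
        have "(\<lambda>i. i)(n := j) = (\<lambda>i. i)" using 1 by auto
        then have "enum_tree (Suc n) (f(Suc n := v)) (\<lambda>i. i) (insert v V) (insert {u, v} E)"
          using enum_tree_leaf[OF f leaf.hyps(2) j(1)] j by simp
        then show ?thesis by (auto simp: path_graph_def)
      next
        case 2
        \<comment> \<open>The new vertex is put in front and the old enumeration is shifted by
          one.\<close>
        let ?g = "case_nat v f"
        have "inj_on ?g {..Suc n}"
          using f' leaf.hyps by (auto simp: inj_on_def atMost_Suc_eq_insert_0)
        moreover have "insert v V = ?g ` {..Suc n}"
          using f' by (simp add: atMost_Suc_eq_insert_0 image_image)
        moreover have "insert {u, v} E = (\<lambda>i. {?g (Suc i), ?g i}) ` {..<Suc n}"
          using f' 2 j by (simp add: lessThan_Suc_eq_insert_0 image_image)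
        ultimately have "enum_tree (Suc n) ?g (\<lambda>i. i) (insert v V) (insert {u, v} E)"
          by (simp add: enum_tree_def)
        then show ?thesis by (auto simp: path_graph_def)
      next
        case 3
        have "built V E" using leaf.hyps by (auto simp: built_def)
        then have b: "built (insert v V) (insert {u, v} E)" using leaf.hyps by (intro built_leaf)
        have "{f j, f (j - 1)} \<in> E" unfolding f'(3) using 3 by (intro image_eqI[of _ _ "j - 1"]) auto
        moreover have "{f j, f (Suc j)} \<in> E"
          unfolding f'(3) using 3 by (intro image_eqI[of _ _ j]) auto
        moreover have "distinct [f j, f (j - 1), f (Suc j), v]"
          using 3 f' leaf.hyps by (auto simp: inj_on_eq_iff)
        ultimately have "branching (insert v V) (insert {u, v} E)"
          using j by (intro built_branching[OF b]) auto
        then show ?thesis by blast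
      qed
    qed
  qed
qed

lemma path_graph_iso:
  assumes "path_graph n V E"
  shows "graph_iso V E (path_V (Suc n)) (path_E (Suc n))"
proof -
  obtain f where f: "inj_on f {..n}" "V = f ` {..n}" "E = (\<lambda>i. {f (Suc i), f i}) ` {..<n}"
    using assms by (auto simp: path_graph_def enum_tree_def)
  define g where "g = the_inv_into {..n} f"
  have g: "g (f i) = i" if "i \<le> n" for i using f that by (simp add: g_def the_inv_into_f_f)
  have "bij_betw g V (path_V (Suc n))"
    using f unfolding g_def path_V_def
    by (metis bij_betw_def bij_betw_the_inv_into atLeast0LessThan lessThan_Suc_atMost)
  moreover have "{f i, f j} \<in> E \<longleftrightarrow> {i, j} \<in> path_E (Suc n)" if "i \<le> n" "j \<le> n" for i j
    using that f by (auto simp: path_E_def doubleton_eq_iff inj_on_eq_iff)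
  then have "\<forall>u\<in>V. \<forall>v\<in>V. {u, v} \<in> E \<longleftrightarrow> {g u, g v} \<in> path_E (Suc n)"
    using g by (auto simp: f(2))
  ultimately show ?thesis unfolding graph_iso_def by blast
qed

lemma graph_iso_path:
  assumes "simple_graph V E" "graph_iso V E (path_V (Suc n)) (path_E (Suc n))"
  shows "path_graph n V E"
proof -
  obtain g where g: "bij_betw g V {..n}" 
    "\<And>u v. u \<in> V \<Longrightarrow> v \<in> V \<Longrightarrow> {u, v} \<in> E \<longleftrightarrow> {g u, g v} \<in> path_E (Suc n)"
    using assms(2) unfolding graph_iso_def path_V_def atLeast0LessThan lessThan_Suc_atMost by blast
  define f where "f = the_inv_into V g"
  have f: "bij_betw f {..n} V" unfolding f_def using g(1) by (rule bij_betw_the_inv_into)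
  have gf: "g (f i) = i" if "i \<le> n" for i
    using g that by (simp add: f_def f_the_inv_into_f_bij_betw)
  have fg: "f (g v) = v" if "v \<in> V" for v
    using g that by (simp add: f_def bij_betw_def the_inv_into_f_f)
  have fV: "f i \<in> V" if "i \<le> n" for i using f that by (auto simp: bij_betw_def)
  have "E = (\<lambda>i. {f (Suc i), f i}) ` {..<n}"
  proof (intro subset_antisym subsetI)
    fix e assume e: "e \<in> E"
    then obtain u v where uv: "e = {u, v}" "u \<in> V" "v \<in> V" using assms by (auto simp: simple_graph_def)
    then have "{g u, g v} \<in> path_E (Suc n)" using e g by blast
    then obtain i where i: "{g u, g v} = {i, Suc i}" "i < n" by (auto simp: path_E_def)
    then have "e = {f (Suc i), f i}" using uv fg[OF uv(2)] fg[OF uv(3)] by (auto simp: doubleton_eq_iff)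
    then show "e \<in> (\<lambda>i. {f (Suc i), f i}) ` {..<n}" using i by blast
  next
    fix e assume "e \<in> (\<lambda>i. {f (Suc i), f i}) ` {..<n}"
    then obtain i where i: "e = {f (Suc i), f i}" "i < n" by blast
    have "{Suc i, i} \<in> path_E (Suc n)" using i by (auto simp: path_E_def)
    then show "e \<in> E" using g(2)[of "f (Suc i)" "f i"] i gf fV by simp
  qed
  then have "enum_tree n f (\<lambda>i. i) V E" using f by (auto simp: enum_tree_def bij_betw_def)
  then show ?thesis by (auto simp: path_graph_def)
qed

section \<open>Vertex and edge counts of a labeling\<close>

lemma card_filter_insert:
  assumes "finite A" "y \<notin> A"
  shows "card {x \<in> insert y A. P x} = card {x \<in> A. P x} + of_bool (P y)"
proof -
  have "{x \<in> insert y A. P x} = (if P y then insert y {x \<in> A. P x} else {x \<in> A. P x})"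
    by auto
  then show ?thesis using assms by simp
qed

lemma fV_insert:
  "finite V \<Longrightarrow> v \<notin> V \<Longrightarrow> fV (insert v V) l a = fV V l a + of_bool (l v = a)"
  unfolding fV_def by (rule card_filter_insert)

text \<open>By commutativity the label of an edge does not depend on the order of its ends, which
  removes the existential in \<open>fE\<close>.\<close>

lemma edge_label_doubleton:
  "(\<exists>u' v'. {u, v} = {u', v'} \<and> u' \<noteq> v' \<and> l u' + l v' = a) \<longleftrightarrow> u \<noteq> v \<and> l u + l v = (a :: 'b :: ab_group_add)"
  by (auto simp: doubleton_eq_iff add.commute)

lemma fE_insert:
  fixes l :: "'a \<Rightarrow> 'b::ab_group_add"
  assumes "finite E" "{u, v} \<notin> E" "u \<noteq> v"
  shows "fE (insert {u, v} E) l a = fE E l a + of_bool (l u + l v = a)"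
  using assms card_filter_insert[OF assms(1,2)] unfolding fE_def by (simp add: edge_label_doubleton)

lemma fV_cong: "(\<And>v. v \<in> V \<Longrightarrow> l v = l' v) \<Longrightarrow> fV V l a = fV V l' a"
  by (auto simp: fV_def intro: arg_cong[where f = card])

lemma fE_cong:
  assumes "simple_graph V E" "\<And>v. v \<in> V \<Longrightarrow> l v = l' v"
  shows "fE E l a = fE E l' a"
proof -
  have "l u + l v = l' u + l' v" if "{u, v} \<in> E" for u v
    using assms(2) simple_graph_subset[OF assms(1) that] by simp
  then have "{e \<in> E. \<exists>u v. e = {u, v} \<and> u \<noteq> v \<and> l u + l v = a} =
      {e \<in> E. \<exists>u v. e = {u, v} \<and> u \<noteq> v \<and> l' u + l' v = a}" by (safe; metis)
  then show ?thesis by (simp add: fE_def)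
qed

lemma leaf_label:
  assumes "simple_graph V E" "v \<notin> V" "u \<in> V"
  shows "fV (insert v V) (l(v := x)) a = fV V l a + of_bool (x = a)"
    and "fE (insert {u, v} E) (l(v := x)) a = fE E l a + of_bool (l u + x = a)"
proof -
  have "{u, v} \<notin> E" using assms simple_graph_subset by fastforce
  moreover have "u \<noteq> v" using assms by auto
  moreover have *: "fV V (l(v := x)) a = fV V l a" "fE E (l(v := x)) a = fE E l a"
    using assms by (auto intro!: fV_cong fE_cong[OF assms(1)])
  ultimately show "fV (insert v V) (l(v := x)) a = fV V l a + of_bool (x = a)"
      "fE (insert {u, v} E) (l(v := x)) a = fE E l a + of_bool (l u + x = a)"
    using assms *
    by (auto simp: fV_insert fE_insert simple_graph_finite simple_graph_finite_edges)
qed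

lemma enum_tree_counts:
  fixes l :: "'a \<Rightarrow> 'b::ab_group_add"
  assumes "enum_tree n f par V E"
  shows "fV V l a = (\<Sum>i\<le>n. of_bool (l (f i) = a)) \<and>
    fE E l a = (\<Sum>i<n. of_bool (l (f (Suc i)) + l (f (par i)) = a))"
  using assms
proof (induction n arbitrary: V E)
  case 0
  then have "{v \<in> V. l v = a} = (if l (f 0) = a then {f 0} else {})" "E = {}"
    by (auto simp: enum_tree_def)
  then show ?case by (simp add: fV_def fE_def)
next
  case (Suc n)
  let ?V = "f ` {..n}" and ?E = "(\<lambda>i. {f (Suc i), f (par i)}) ` {..<n}"
  have new: "f (Suc n) \<notin> ?V"
    using Suc.prems by (auto simp: enum_tree_def inj_on_eq_iff)
  have par: "par i \<le> i" if "i \<le> n" for i using Suc.prems that by (simp add: enum_tree_def)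
  have "enum_tree n f par ?V ?E"
    using Suc.prems by (auto simp: enum_tree_def inj_on_def)
  note IH = Suc.IH[OF this]
  have VE: "V = insert (f (Suc n)) ?V" "E = insert {f (Suc n), f (par n)} ?E"
    using Suc.prems by (auto simp: enum_tree_def atMost_Suc lessThan_Suc)
  have "e \<subseteq> ?V" if "e \<in> ?E" for e using that par le_trans[OF par] by (auto intro!: imageI)
  then have "{f (Suc n), f (par n)} \<notin> ?E" using new by blast
  moreover have "f (Suc n) \<noteq> f (par n)" using new par[of n] by auto
  ultimately have "fE E l a = fE ?E l a + of_bool (l (f (Suc n)) + l (f (par n)) = a)"
    unfolding VE by (intro fE_insert) simp_all
  moreover have "fV V l a = fV ?V l a + of_bool (l (f (Suc n)) = a)"
    unfolding VE by (intro fV_insert new) simp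
  ultimately show ?case using IH by simp
qed

lemma enum_tree_label:
  fixes lab :: "nat \<Rightarrow> 'b::ab_group_add"
  assumes "enum_tree n f par V E"
  obtains l where "\<And>a. fV V l a = (\<Sum>i\<le>n. of_bool (lab i = a))"
    "\<And>a. fE E l a = (\<Sum>i<n. of_bool (lab (Suc i) + lab (par i) = a))"
proof -
  let ?l = "lab \<circ> the_inv_into {..n} f"
  have "?l (f i) = lab i" if "i \<le> n" for i
    using assms that by (simp add: enum_tree_def the_inv_into_f_f)
  moreover have "par i \<le> n" if "i < n" for i using assms that unfolding enum_tree_def by fastforce
  ultimately show thesis
    using that[of ?l] enum_tree_counts[OF assms, of ?l] by simp
qed

subsection \<open>Finite checks in the Klein four-group\<close>

abbreviation "k0 \<equiv> (0, 0) :: klein4"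
abbreviation "k1 \<equiv> (0, 1) :: klein4"
abbreviation "k2 \<equiv> (1, 0) :: klein4"
abbreviation "k3 \<equiv> (1, 1) :: klein4"

definition klein4_list :: "klein4 list" where
  "klein4_list = [k0, k1, k2, k3]"

lemma set_klein4_list [simp]: "set klein4_list = UNIV"
proof -
  have "x \<in> set klein4_list" for x :: klein4
    by (cases x; cases "fst x"; cases "snd x") (auto simp: klein4_list_def)
  then show ?thesis by blast
qed

lemma all_klein4: "(\<forall>x. P x) \<longleftrightarrow> list_all P klein4_list"
  by (simp add: list_all_iff)

text \<open>These are the 24 ways to label four new vertices so that every vertex count rises by
  one.\<close>

definition klein4_orders :: "klein4 list list" where
  "klein4_orders =
    [[w, x, y, z]. w \<leftarrow> klein4_list, x \<leftarrow> klein4_list, y \<leftarrow> klein4_list, z \<leftarrow> klein4_list,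
      distinct [w, x, y, z]]"

text \<open>
  Edge counts of a tree with \<open>4 * k\<close> vertices: every label occurs \<open>k\<close> times, except \<open>d\<close>, which
  occurs once less. In \<open>shifts\<close>, four new edges move the deficient label from \<open>d\<close> to \<open>d'\<close>.
\<close>

definition all_but :: "nat \<Rightarrow> klein4 \<Rightarrow> klein4 list \<Rightarrow> bool" where
  "all_but k d es \<longleftrightarrow> list_all (\<lambda>a. count_list es a + of_bool (a = d) = k) klein4_list"

definition shifts :: "klein4 \<Rightarrow> klein4 \<Rightarrow> klein4 list \<Rightarrow> bool" where
  "shifts d d' es \<longleftrightarrow>
    list_all (\<lambda>a. count_list es a + of_bool (a = d') = Suc (of_bool (a = d))) klein4_list"

text \<open>\<open>None\<close> marks a leaf whose parent is the new vertex with label \<open>x\<close>.\<close>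

definition parent_label :: "klein4 \<Rightarrow> klein4 option \<Rightarrow> klein4" where
  "parent_label x p = (case p of None \<Rightarrow> x | Some y \<Rightarrow> y)"

text \<open>The first new vertex hangs off an old vertex with label 0, so its edge has label
  \<open>xs ! 0\<close>. Each of the other three hangs off an old vertex or off the first new
  one.\<close>

lemma four_leaves_table:
  "list_all (\<lambda>d. list_all (\<lambda>p. list_all (\<lambda>q. list_all (\<lambda>r.
     list_ex (\<lambda>xs. list_ex (\<lambda>d'. shifts d d' [xs ! 0, 
        parent_label (xs ! 0) p + xs ! 1, parent_label (xs ! 0) q + xs ! 2,
        parent_label (xs ! 0) r + xs ! 3]) klein4_list) klein4_orders)
     (None # map Some klein4_list)) (None # map Some klein4_list))
     (None # map Some klein4_list)) klein4_list"
  by code_simp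

text \<open>Here \<open>p\<close> is the label of the old end. For \<open>d = k0\<close> there is no
  solution: only the first edge can have label 0, so the other three would carry the three nonzero
  labels, whose sum 0 would make \<open>xs ! 3\<close> equal to \<open>xs ! 0\<close>.\<close>

lemma path_table:
  "list_all (\<lambda>p. list_all (\<lambda>d. list_ex (\<lambda>xs. list_ex (\<lambda>d'. shifts d d' [xs ! 0 + p,
     xs ! 1 + xs ! 0, xs ! 2 + xs ! 1, xs ! 3 + xs ! 2]) [k1, k2, k3]) klein4_orders) [k1, k2, k3])
   klein4_list"
  by code_simp

text \<open>
  A greedy cover: each of the trees with eight vertices \<open>0, \<dots>, 7\<close> that are grown from the star
  with center \<open>0\<close> and leaves \<open>1, 2, 3\<close> is labeled cordially by one of these lists.
\<close>

definition labels8 :: "klein4 list list" where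
  "labels8 = [
    [k0,k0,k1,k2,k1,k2,k3,k3],
    [k0,k0,k1,k2,k3,k3,k2,k1],
    [k0,k0,k1,k2,k2,k3,k1,k3],
    [k0,k0,k1,k2,k3,k1,k3,k2],
    [k0,k1,k2,k0,k3,k3,k2,k1],
    [k0,k0,k1,k2,k3,k1,k2,k3],
    [k0,k1,k0,k2,k3,k2,k3,k1],
    [k0,k1,k2,k0,k2,k3,k3,k1],
    [k0,k1,k0,k2,k3,k3,k1,k2],
    [k0,k1,k0,k2,k1,k3,k2,k3],
    [k0,k1,k2,k0,k3,k3,k1,k2],
    [k0,k1,k1,k0,k2,k3,k2,k3],
    [k0,k1,k0,k1,k2,k2,k3,k3],
    [k0,k1,k2,k1,k2,k3,k3,k0],
    [k0,k1,k1,k0,k2,k2,k3,k3],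
    [k0,k1,k2,k1,k3,k3,k0,k2],
    [k0,k1,k2,k1,k3,k3,k2,k0],
    [k0,k0,k1,k1,k2,k2,k3,k3],
    [k0,k1,k0,k2,k2,k3,k3,k1],
    [k0,k1,k1,k2,k3,k2,k3,k0],
    [k0,k0,k1,k1,k2,k3,k3,k2],
    [k0,k0,k1,k2,k3,k2,k1,k3],
    [k0,k1,k1,k0,k2,k3,k3,k2]]"

text \<open>The parents of the vertices 4 to 7 range over all earlier vertices, which gives 4 * 5 *
  6 * 7 = 840 cases.\<close>

lemma labels8_table:
  "list_all (\<lambda>i. list_all (\<lambda>j. list_all (\<lambda>k. list_all (\<lambda>m.
     list_ex (\<lambda>xs. list_ex (\<lambda>d. all_but 2 d [xs ! 1 + xs ! 0, xs ! 2 + xs ! 0, xs ! 3 + xs ! 0,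
       xs ! 4 + xs ! i, xs ! 5 + xs ! j, xs ! 6 + xs ! k, xs ! 7 + xs ! m]) klein4_list) labels8)
     [0..<7]) [0..<6]) [0..<5]) [0..<4]"
  by code_simp

lemma klein4_orders_table:
  "list_all (\<lambda>xs. length xs = 4 \<and> list_all (\<lambda>a. count_list xs a = 1) klein4_list) klein4_orders"
  by code_simp

lemma labels8_counts:
  "list_all (\<lambda>xs. length xs = 8 \<and> list_all (\<lambda>a. count_list xs a = 2) klein4_list) labels8"
  by code_simp

definition near_equal :: "klein4 list \<Rightarrow> bool" where
  "near_equal xs \<longleftrightarrow>
    list_all (\<lambda>a. list_all (\<lambda>b. count_list xs a \<le> Suc (count_list xs b)) klein4_list) klein4_list"

text \<open>Balanced vertices have four distinct labels, so the three edge labels are nonzero.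
  Balanced edges would be the three nonzero elements with sum 0, but their sum is
  \<open>a + d\<close>, which is nonzero.\<close>

lemma path4_table:
  "list_all (\<lambda>a. list_all (\<lambda>b. list_all (\<lambda>c. list_all (\<lambda>d.
     near_equal [a, b, c, d] \<longrightarrow> \<not> near_equal [b + a, c + b, d + c])
   klein4_list) klein4_list) klein4_list) klein4_list"
  by code_simp

text \<open>Balanced edges would carry every label once, so their sum \<open>a + e\<close> would be
  0. Then \<open>a = e\<close> is the only repeated vertex label, and no edge can have label
  0.\<close>

lemma path5_table:
  "list_all (\<lambda>a. list_all (\<lambda>b. list_all (\<lambda>c. list_all (\<lambda>d. list_all (\<lambda>e.
     near_equal [a, b, c, d, e] \<longrightarrow> \<not> near_equal [b + a, c + b, d + c, e + d])
   klein4_list) klein4_list) klein4_list) klein4_list) klein4_list"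
  by code_simp

subsection \<open>Cordial labelings\<close>

text \<open>Labels are pairs; quantifiers over them are to stay whole instead of being split into
  coordinates.\<close>

declare split_paired_All [simp del] split_paired_Ex [simp del]

lemma klein4_add_self [simp]: "x + x = 0" for x :: klein4
  by (cases x; cases "fst x"; cases "snd x") (auto simp: zero_prod_def)

lemma klein4_add_cancel [simp]: "x + (x + y) = y" "x + y + x = y" for x y :: klein4
proof -
  show "x + (x + y) = y" by (simp flip: add.assoc)
  then show "x + y + x = y" by (simp add: add.commute)
qed

lemma card_klein4: "card (UNIV :: klein4 set) = 4"
  unfolding set_klein4_list[symmetric] by (subst distinct_card) (simp_all add: klein4_list_def)

lemma finite_klein4 [simp]: "finite (S :: klein4 set)"
  by (rule finite_subset[OF _ finite_set[of klein4_list]]) simp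

lemma count_list_Cons: "count_list (x # xs) a = of_bool (x = a) + count_list xs a"
  by auto

lemma count_list_conv_sum: "count_list xs a = (\<Sum>i<length xs. of_bool (xs ! i = a))"
proof (induction xs)
  case (Cons x xs)
  then show ?case by (simp add: sum.lessThan_Suc_shift del: sum.lessThan_Suc)
qed simp

lemma klein4_orders_count:
  assumes "xs \<in> set klein4_orders"
  shows "length xs = 4" "count_list xs a = 1"
  using klein4_orders_table assms by (auto simp: list_all_iff)

lemma list_length4: "length xs = 4 \<Longrightarrow> xs = [xs ! 0, xs ! 1, xs ! 2, xs ! 3]"
  by (rule nth_equalityI) (auto simp: less_Suc_eq eval_nat_numeral)

lemma klein4_four_leaves:
  fixes d s :: klein4 and p q r :: "klein4 option"
  obtains w x y z d' where "\<And>a. count_list [w, x, y, z] a = 1"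
    "\<And>a. count_list [s + w, parent_label w p + x, parent_label w q + y, parent_label w r + z] a
       + of_bool (a = d') = Suc (of_bool (a = d))"
proof -
  \<comment> \<open>adding \<open>s\<close> to all labels reduces to the case \<open>s = 0\<close> covered by the table\<close>
  let ?sh = "map_option (\<lambda>t. t + s)"
  have opt: "t \<in> set (None # map Some klein4_list)" for t
    by (cases t) auto
  obtain xs d' where xs: "xs \<in> set klein4_orders"
    "shifts d d' [xs ! 0, parent_label (xs ! 0) (?sh p) + xs ! 1,
       parent_label (xs ! 0) (?sh q) + xs ! 2, parent_label (xs ! 0) (?sh r) + xs ! 3]"
    using four_leaves_table opt[of "?sh p"] opt[of "?sh q"] opt[of "?sh r"]
    unfolding list_all_iff list_ex_iff set_klein4_list by blast
  \<comment> \<open>Adding \<open>s\<close> to both ends of an edge preserves its label. If the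
    parent is old, the shift passes from the leaf to the parent.\<close>
  have shift: "parent_label (t + s) o' + (t' + s) = parent_label t (?sh o') + t'" for t t' o'
    by (cases o') (simp_all add: parent_label_def ac_simps)
  have eq: "t + s = a \<longleftrightarrow> t = a + s" for t a by (auto simp: add.assoc)
  have "count_list [xs ! 0, xs ! 1, xs ! 2, xs ! 3] a = 1" for a
    using klein4_orders_count[OF xs(1)] list_length4[of xs] by simp
  then have "count_list [xs ! 0 + s, xs ! 1 + s, xs ! 2 + s, xs ! 3 + s] a = 1" for a
    unfolding count_list_Cons eq by simp
  moreover have "s + (xs ! 0 + s) = xs ! 0" by (simp add: ac_simps)
  ultimately show thesis
    using that[of "xs ! 0 + s" "xs ! 1 + s" "xs ! 2 + s" "xs ! 3 + s" d'] xs(2)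
    by (simp only: shift shifts_def list_all_iff set_klein4_list ball_UNIV)
qed

text \<open>
  A cordial labeling of a tree with \<open>4 * q + r + 1\<close> vertices, where \<open>r < 4\<close>; for \<open>r = 3\<close> all vertex
  counts are \<open>q + 1\<close> and exactly one edge label is deficient.
\<close>

definition balanced :: "nat \<Rightarrow> nat \<Rightarrow> 'a set \<Rightarrow> 'a set set \<Rightarrow> bool" where
  "balanced q r V E \<longleftrightarrow> (\<exists>(l :: 'a \<Rightarrow> klein4) A B. card A = Suc r \<and> card B = r \<and>
     (\<forall>a. fV V l a = q + of_bool (a \<in> A) \<and> fE E l a = q + of_bool (a \<in> B)))"

section \<open>Extending balanced labelings\<close>

lemma balanced_cordial:
  assumes "balanced q r V E"
  shows "cordial TYPE(klein4) V E"
proof -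
  obtain l :: "'a \<Rightarrow> klein4" and A B where
    "\<forall>a. fV V l a = q + of_bool (a \<in> A) \<and> fE E l a = q + of_bool (a \<in> B)"
    using assms unfolding balanced_def by blast
  then have "cordial_labeling V E l" by (simp add: cordial_labeling_def)
  then show ?thesis unfolding cordial_def by blast
qed

text \<open>Vertex balance forbids \<open>r + 1\<close> labels for the leaf and edge balance forbids
  \<open>r\<close>. For \<open>r < 2\<close> these are at most three of the four labels.\<close>

lemma balanced_leaf:
  assumes bal: "balanced q r V E" and "r < 2"
    and leaf: "simple_graph V E" "v \<notin> V" "u \<in> V"
  shows "balanced q (Suc r) (insert v V) (insert {u, v} E)"
proof -
  obtain l :: "'a \<Rightarrow> klein4" and A B where l: "card A = Suc r" "card B = r"
    "\<And>a. fV V l a = q + of_bool (a \<in> A)" "\<And>a. fE E l a = q + of_bool (a \<in> B)"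
    using bal unfolding balanced_def by blast
  have "\<exists>x. x \<notin> A \<and> l u + x \<notin> B"
  proof (rule ccontr)
    assume *: "\<not> ?thesis"
    have "x \<in> A \<union> (+) (l u) ` B" for x
      using * image_eqI[of x "(+) (l u)" "l u + x" B] by auto
    then have "UNIV \<subseteq> A \<union> (+) (l u) ` B" by blast
    then have "card (UNIV :: klein4 set) \<le> card (A \<union> (+) (l u) ` B)" by (intro card_mono) auto
    also have "\<dots> \<le> card A + card ((+) (l u) ` B)" by (rule card_Un_le)
    also have "\<dots> \<le> card A + card B" by (simp add: card_image_le)
    finally show False using l \<open>r < 2\<close> card_klein4 by simp
  qed
  then obtain x where x: "x \<notin> A" "l u + x \<notin> B" by blast
  show ?thesis unfolding balanced_def
  proof (intro exI conjI allI)
    show "card (insert x A) = Suc (Suc r)" "card (insert (l u + x) B) = Suc r"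
      using x l by simp_all
    show "fV (insert v V) (l(v := x)) a = q + of_bool (a \<in> insert x A)"
      "fE (insert {u, v} E) (l(v := x)) a = q + of_bool (a \<in> insert (l u + x) B)" for a
      using x by (auto simp: leaf_label[OF leaf] l)
  qed
qed

lemma balanced_3_iff:
  "balanced q 3 V E \<longleftrightarrow>
    (\<exists>(l :: 'a \<Rightarrow> klein4) d. \<forall>a. fV V l a = Suc q \<and> fE E l a + of_bool (a = d) = Suc q)"
proof
  assume "balanced q 3 V E"
  then obtain l :: "'a \<Rightarrow> klein4" and A B where l: "card A = 4" "card B = 3"
    "\<And>a. fV V l a = q + of_bool (a \<in> A)" "\<And>a. fE E l a = q + of_bool (a \<in> B)"
    unfolding balanced_def by (auto simp: eval_nat_numeral)
  have A: "A = UNIV" using l(1) card_klein4 by (intro card_subset_eq) auto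
  have "card (- B) = 1" using l(2) card_klein4 by (simp add: Compl_eq_Diff_UNIV card_Diff_subset)
  then obtain d where "- B = {d}" by (auto simp: card_1_singleton_iff)
  then have B: "B = - {d}" by auto
  show "\<exists>(l :: 'a \<Rightarrow> klein4) d. \<forall>a. fV V l a = Suc q \<and> fE E l a + of_bool (a = d) = Suc q"
    by (rule exI[of _ l], rule exI[of _ d]) (auto simp: l A B)
next
  assume "\<exists>(l :: 'a \<Rightarrow> klein4) d. \<forall>a. fV V l a = Suc q \<and> fE E l a + of_bool (a = d) = Suc q"
  then obtain l :: "'a \<Rightarrow> klein4" and d
    where l: "\<And>a. fV V l a = Suc q" "\<And>a. fE E l a + of_bool (a = d) = Suc q" by blast
  have "fE E l a = q + of_bool (a \<in> - {d})" for a using l(2)[of a] by (cases "a = d") auto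
  then show "balanced q 3 V E" unfolding balanced_def
    using l card_klein4
    by (intro exI[of _ l] exI[of _ UNIV] exI[of _ "- {d}"])
      (auto simp: Compl_eq_Diff_UNIV card_Diff_subset)
qed

text \<open>The new edge must receive the deficient label \<open>d\<close>, which determines the
  label of the leaf. Any label is allowed there, since all vertex counts are equal.\<close>

lemma balanced_leaf_wrap:
  assumes bal: "balanced q 3 V E" and leaf: "simple_graph V E" "v \<notin> V" "u \<in> V"
  shows "balanced (Suc q) 0 (insert v V) (insert {u, v} E)"
proof -
  obtain l :: "'a \<Rightarrow> klein4" and d where l: "\<And>a. fV V l a = Suc q"
    "\<And>a. fE E l a + of_bool (a = d) = Suc q"
    using bal unfolding balanced_3_iff by blast
  let ?l = "l(v := l u + d)"
  have "fV (insert v V) ?l a = Suc q + of_bool (a \<in> {l u + d})"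
    "fE (insert {u, v} E) ?l a = Suc q + of_bool (a \<in> {})" for a
    using l(2)[of a] by (auto simp: leaf_label[OF leaf] l(1))
  then show ?thesis unfolding balanced_def
    by (intro exI[of _ ?l] exI[of _ "{l u + d}"] exI[of _ "{}"]) auto
qed

text \<open>Three leaves and then a leaf \<open>v\<close> of the remaining tree are removed. The
  induction hypothesis speaks of all trees of the smaller size because the rest \<open>W'\<close>
  need not be branching.\<close>

lemma balanced_branching_step:
  fixes V :: "'a set"
  assumes br: "branching V E" and card: "6 \<le> card V"
    and IH: "\<And>(V' :: 'a set) E'. built V' E' \<Longrightarrow> card V' + 4 = card V \<Longrightarrow> balanced q 3 V' E'"
  shows "balanced (Suc q) 3 V E"
proof -
  obtain W F x y z px py pz where W: "built W F" "distinct [x, y, z]" "W \<inter> {x, y, z} = {}"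
    "{px, py, pz} \<subseteq> W" "V = insert z (insert y (insert x W))"
    "E = insert {pz, z} (insert {py, y} (insert {px, x} F))"
    using branching_three_leaves[OF br] by blast
  have fin: "finite W" using W(1) by (blast intro: built_simple simple_graph_finite)
  have ne: "py \<noteq> x" "pz \<noteq> x" "pz \<noteq> y" "x \<notin> W" "y \<notin> insert x W" "z \<notin> insert y (insert x W)"
    using W by auto
  have cW: "card V = card W + 3" unfolding W(5) using ne(4-6) fin by (simp del: insert_iff)
  have "card W \<noteq> 1" using cW card by simp
  then obtain W' F' u v where W': "built W' F'" "u \<in> W'" "v \<notin> W'" "W = insert v W'" "F = insert {u, v} F'"
    by (rule built_remove_leaf[OF W(1)])
  have "card V = card W' + 4" using cW W' fin by simp
  then obtain l :: "'a \<Rightarrow> klein4" and d where l: "\<And>a. fV W' l a = Suc q"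
    "\<And>a. fE F' l a + of_bool (a = d) = Suc q"
    using IH[OF W'(1)] unfolding balanced_3_iff by auto
  \<comment> \<open>The parents of the three leaves lie in \<open>W\<close>, so \<open>v\<close> is
    the only one among them whose label is still to be chosen.\<close>
  define opt where "opt t = (if t = v then None else Some (l t))" for t
  obtain kv kx ky kz d' where k: "\<And>a. count_list [kv, kx, ky, kz] a = 1"
    "\<And>a. count_list [l u + kv, parent_label kv (opt px) + kx, parent_label kv (opt py) + ky,
        parent_label kv (opt pz) + kz] a + of_bool (a = d') = Suc (of_bool (a = d))"
    by (rule klein4_four_leaves[of "l u" "opt px" "opt py" "opt pz" d]) blast
  have par: "(l(v := kv)) t = parent_label kv (opt t)" for t
    by (simp add: opt_def parent_label_def)
  let ?l = "l(v := kv, x := kx, y := ky, z := kz)"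
  have sW: "simple_graph W' F'" "simple_graph W F"
    using W'(1) W(1) by (simp_all add: built_simple)
  have sx: "simple_graph (insert x W) (insert {px, x} F)"
    using W by (intro simple_graph_leaf sW) auto
  have sy: "simple_graph (insert y (insert x W)) (insert {py, y} (insert {px, x} F))"
    using W by (intro simple_graph_leaf sx) auto
  have pp: "px \<in> W" "py \<in> insert x W" "pz \<in> insert y (insert x W)" using W by auto
  note lz = leaf_label[OF sy ne(6) pp(3)] and ly = leaf_label[OF sx ne(5) pp(2)]
    and lx = leaf_label[OF sW(2) ne(4) pp(1)] and lv = leaf_label[OF sW(1) W'(3,2)]
  have "fV W (l(v := kv)) a = Suc q + of_bool (kv = a)" for a
    unfolding W'(4) lv(1) l by simp
  then have vertices: "fV V ?l a = Suc q + count_list [kv, kx, ky, kz] a" for a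
    unfolding W(5) lz(1) ly(1) lx(1) count_list_Cons by simp
  have "fE F (l(v := kv)) a = fE F' l a + of_bool (l u + kv = a)" for a
    unfolding W'(5) by (rule lv(2))
  then have edges: "fE E ?l a = fE F' l a + count_list [l u + kv, parent_label kv (opt px) + kx,
      parent_label kv (opt py) + ky, parent_label kv (opt pz) + kz] a" for a
    unfolding W(6) lz(2) ly(2) lx(2) count_list_Cons par[symmetric] using ne by simp
  have "fV V ?l a = Suc (Suc q) \<and> fE E ?l a + of_bool (a = d') = Suc (Suc q)" for a
    using vertices[of a] edges[of a] k(1)[of a] k(2)[of a] l(2)[of a] by linarith
  then show ?thesis unfolding balanced_3_iff by blast
qed

text \<open>
  The four-vertex extension of a path fails when the deficient edge label is \<open>0\<close>, so the induction
  keeps that label nonzero.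
\<close>

lemma klein4_path_labels:
  "\<exists>lab d. d \<noteq> k0 \<and> (\<forall>a. (\<Sum>i\<le>4 * k + 7. of_bool (lab i = a)) = k + 2 \<and>
     (\<Sum>i<4 * k + 7. of_bool (lab (Suc i) + lab i = a)) + of_bool (a = d) = k + 2)"
proof (induction k)
  case 0
  \<comment> \<open>The edges carry \<open>k0\<close>, \<open>k1\<close>, \<open>k3\<close> twice
    each and \<open>k2\<close> once, so the deficient label \<open>k2\<close> is nonzero.\<close>
  let ?xs = "[k0, k0, k1, k2, k1, k3, k3, k2]"
  show ?case
    by (rule exI[of _ "(!) ?xs"], rule exI[of _ k2])
      (simp add: all_klein4 klein4_list_def eval_nat_numeral zero_prod_def)
next
  case (Suc k)
  then obtain lab d where IH: "d \<noteq> k0" "\<And>a. (\<Sum>i\<le>4 * k + 7. of_bool (lab i = a)) = k + 2"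
     "\<And>a. (\<Sum>i<4 * k + 7. of_bool (lab (Suc i) + lab i = a)) + of_bool (a = d) = k + 2" by blast
  let ?m = "4 * k + 7"
  have "d \<in> set [k1, k2, k3]" using IH(1) by (cases d; cases "fst d"; cases "snd d") auto
  then obtain xs d' where xs: "xs \<in> set klein4_orders" "d' \<in> set [k1, k2, k3]"
    "shifts d d' [xs ! 0 + lab ?m, xs ! 1 + xs ! 0, xs ! 2 + xs ! 1, xs ! 3 + xs ! 2]"
    using path_table unfolding list_all_iff list_ex_iff set_klein4_list by blast
  define m where "m = 4 * k + 7"
  define lab' where "lab' i = (if i \<le> m then lab i else xs ! (i - Suc m))" for i
  have m: "4 * Suc k + 7 = Suc (Suc (Suc (Suc m)))" by (simp add: m_def)
  have old: "(\<Sum>i\<le>m. of_bool (lab' i = a)) = (\<Sum>i\<le>m. of_bool (lab i = a))"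
    "(\<Sum>i<m. of_bool (lab' (Suc i) + lab' i = a)) = (\<Sum>i<m. of_bool (lab (Suc i) + lab i = a))" for a
    by (intro sum.cong; simp add: lab'_def)+
  have new: "lab' m = lab m" "lab' (Suc m) = xs ! 0" "lab' (Suc (Suc m)) = xs ! 1"
    "lab' (Suc (Suc (Suc m))) = xs ! 2" "lab' (Suc (Suc (Suc (Suc m)))) = xs ! 3"
    by (simp_all add: lab'_def eval_nat_numeral)
  have "count_list [xs ! 0, xs ! 1, xs ! 2, xs ! 3] a = 1" for a
    using klein4_orders_count[OF xs(1)] list_length4[of xs] by simp
  then have "(\<Sum>i\<le>4 * Suc k + 7. of_bool (lab' i = a)) = Suc k + 2" for a
    using IH(2)[of a, folded m_def] unfolding m sum.atMost_Suc new old count_list_Cons by simp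
  moreover have "count_list [xs ! 0 + lab m, xs ! 1 + xs ! 0, xs ! 2 + xs ! 1, xs ! 3 + xs ! 2] a
      + of_bool (a = d') = Suc (of_bool (a = d))" for a
    using xs(3)[folded m_def] unfolding shifts_def list_all_iff set_klein4_list by blast
  note edges = this
  have "(\<Sum>i<4 * Suc k + 7. of_bool (lab' (Suc i) + lab' i = a)) + of_bool (a = d') = Suc k + 2" for a
    using IH(3)[of a, folded m_def] edges[of a]
    unfolding m sum.lessThan_Suc new old count_list_Cons count_list.simps(1)
    by linarith
  moreover have "d' \<noteq> k0" using xs(2) by auto
  ultimately show ?case by blast
qed

lemma balanced_path:
  assumes "path_graph (4 * k + 7) V E"
  shows "balanced (Suc k) 3 V E"
proof -
  obtain lab :: "nat \<Rightarrow> klein4" and d where lab: "\<forall>a. (\<Sum>i\<le>4 * k + 7. of_bool (lab i = a)) = k + 2 \<and>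
     (\<Sum>i<4 * k + 7. of_bool (lab (Suc i) + lab i = a)) + of_bool (a = d) = k + 2"
    using klein4_path_labels[of k] by blast
  obtain f where f: "enum_tree (4 * k + 7) f (\<lambda>i. i) V E" using assms by (auto simp: path_graph_def)
  obtain l where l: "\<And>a. fV V l a = (\<Sum>i\<le>4 * k + 7. of_bool (lab i = a))"
    "\<And>a. fE E l a = (\<Sum>i<4 * k + 7. of_bool (lab (Suc i) + lab i = a))"
    by (rule enum_tree_label[OF f, of lab]) blast
  have "\<forall>a. fV V l a = Suc (Suc k) \<and> fE E l a + of_bool (a = d) = Suc (Suc k)"
    unfolding l using lab by simp
  then show ?thesis unfolding balanced_3_iff by blast
qed

text \<open>This path is labeled by hand, since removing an end leaves the path on five vertices,
  which has no cordial labeling.\<close>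

lemma balanced_path6:
  assumes "path_graph 5 V E"
  shows "balanced 1 1 V E"
proof -
  obtain f where f: "enum_tree 5 f (\<lambda>i. i) V E" using assms by (auto simp: path_graph_def)
  let ?xs = "[k0, k0, k1, k2, k1, k3]"
  obtain l where l: "\<And>a. fV V l a = (\<Sum>i\<le>5. of_bool (?xs ! i = a))"
    "\<And>a. fE E l a = (\<Sum>i<5. of_bool (?xs ! Suc i + ?xs ! i = a))"
    by (rule enum_tree_label[OF f, of "(!) ?xs"]) blast
  have "\<forall>a. fV V l a = 1 + of_bool (a \<in> {k0, k1}) \<and> fE E l a = 1 + of_bool (a \<in> {k3})"
    unfolding l by (simp add: all_klein4 klein4_list_def eval_nat_numeral zero_prod_def)
  then show ?thesis unfolding balanced_def
    by (intro exI[of _ l] exI[of _ "{k0, k1}"] exI[of _ "{k3}"]) auto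
qed

text \<open>With the center labeled 0, each edge carries the label of its leaf, and the deficient
  edge label is 0.\<close>

lemma balanced_star:
  assumes "branching V E" "card V = 4"
  shows "balanced 0 3 V E"
proof -
  obtain n f par where f: "enum_tree n f par V E" "par 0 = 0" "par 1 = 0" "par 2 = 0"
    using branching_enum[OF assms(1)] by metis
  have [simp]: "n = 3" using enum_tree_card[OF f(1)] assms by simp
  let ?xs = "[k0, k1, k2, k3]"
  obtain l where l: "\<And>a. fV V l a = (\<Sum>i\<le>n. of_bool (?xs ! i = a))"
    "\<And>a. fE E l a = (\<Sum>i<n. of_bool (?xs ! Suc i + ?xs ! par i = a))"
    by (rule enum_tree_label[OF f(1), of "(!) ?xs"]) blast
  have "\<forall>a. fV V l a = Suc 0 \<and> fE E l a + of_bool (a = k0) = Suc 0"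
    unfolding l using f(2-4) by (simp add: all_klein4 klein4_list_def eval_nat_numeral zero_prod_def)
  then show ?thesis unfolding balanced_3_iff by blast
qed

lemma balanced_branching8:
  assumes "branching V E" "card V = 8"
  shows "balanced 1 3 V E"
proof -
  obtain n f par where f: "enum_tree n f par V E" "par 0 = 0" "par 1 = 0" "par 2 = 0"
    using branching_enum[OF assms(1)] by metis
  have n [simp]: "n = 7" using enum_tree_card[OF f(1)] assms by simp
  have le: "par i \<le> i" if "i < 7" for i using f(1) that by (simp add: enum_tree_def)
  have "par 3 \<in> set [0..<4]" "par 4 \<in> set [0..<5]" "par 5 \<in> set [0..<6]" "par 6 \<in> set [0..<7]"
    using le[of 3] le[of 4] le[of 5] le[of 6] by simp_all
  then obtain xs d where xs: "xs \<in> set labels8" "all_but 2 d [xs ! 1 + xs ! 0, xs ! 2 + xs ! 0,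
     xs ! 3 + xs ! 0, xs ! 4 + xs ! par 3, xs ! 5 + xs ! par 4, xs ! 6 + xs ! par 5, xs ! 7 + xs ! par 6]"
    using labels8_table unfolding list_all_iff list_ex_iff by blast
  have len: "length xs = 8" and cnt: "\<And>a. count_list xs a = 2"
    using labels8_counts xs(1) by (auto simp: list_all_iff)
  obtain l where l: "\<And>a. fV V l a = (\<Sum>i\<le>n. of_bool (xs ! i = a))"
    "\<And>a. fE E l a = (\<Sum>i<n. of_bool (xs ! Suc i + xs ! par i = a))"
    by (rule enum_tree_label[OF f(1), of "(!) xs"]) blast
  have sum7: "(\<Sum>i<7. g i) = g 0 + g 1 + g 2 + g 3 + g 4 + g 5 + g 6" for g :: "nat \<Rightarrow> nat"
    by (simp add: eval_nat_numeral)
  have num: "Suc 0 = 1" "Suc 1 = 2" "Suc 2 = 3" "Suc 3 = 4" "Suc 4 = 5" "Suc 5 = 6" "Suc 6 = 7"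
    by simp_all
  have edges: "count_list [xs ! 1 + xs ! 0, xs ! 2 + xs ! 0, xs ! 3 + xs ! 0, xs ! 4 + xs ! par 3,
      xs ! 5 + xs ! par 4, xs ! 6 + xs ! par 5, xs ! 7 + xs ! par 6] a + of_bool (a = d) = 2" for a
    using xs(2) unfolding all_but_def list_all_iff set_klein4_list by blast
  have "fV V l a = Suc 1" for a
    using cnt[of a] len unfolding l count_list_conv_sum n by (simp add: lessThan_Suc_atMost[symmetric])
  moreover have "fE E l a + of_bool (a = d) = Suc 1" for a
    using edges[of a] unfolding l n sum7 num f(2-4) count_list_Cons count_list.simps(1) by linarith
  ultimately show ?thesis unfolding balanced_3_iff by blast
qed

text \<open>Strong induction on the number of vertices. Multiples of four are reached from stars,
  paths, eight vertices or four vertices fewer; all other sizes above one are reached by adding one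
  leaf, except for the path on six vertices.\<close>

lemma built_balanced:
  assumes "built V E" "card V \<in> {4, 5} \<Longrightarrow> branching V E" "card V = 4 * q + r + 1" "r < 4"
  shows "balanced q r V E"
  using assms
proof (induction "card V" arbitrary: V E q r rule: less_induct)
  case less
  show ?case
  proof (cases "r = 3")
    case True
    consider "q = 0" | n where "q \<ge> 1" "path_graph n V E" | "q = 1" "branching V E" | "q \<ge> 2" "branching V E"
      using path_or_branching[OF less.prems(1)] by (metis One_nat_def Suc_1 Suc_leI le_antisym less_one linorder_not_le)
    then show ?thesis
    proof cases
      case 1
      then show ?thesis using less.prems True balanced_star by auto
    next
      case 2
      then obtain f where f: "enum_tree n f (\<lambda>i. i) V E" by (auto simp: path_graph_def)
      obtain k where k: "q = Suc k" using 2 by (cases q) auto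
      have "n = 4 * k + 7" using enum_tree_card[OF f] less.prems(3) k True by simp
      then show ?thesis using balanced_path[of k V E] 2 k True by simp
    next
      case 3
      then show ?thesis using less.prems True balanced_branching8 by auto
    next
      case 4
      then obtain k where k: "q = Suc k" by (cases q) auto
      have "balanced (Suc k) 3 V E"
      proof (rule balanced_branching_step[OF 4(2)])
        fix V' :: "'a set" and E' assume "built V' E'" "card V' + 4 = card V"
        \<comment> \<open>Since \<open>q\<close> is at least 2, the smaller tree has at least eight
          vertices and cannot be an exceptional path.\<close>
        then show "balanced k 3 V' E'" using less.prems True 4 k by (intro less.hyps) auto
      qed (use less.prems 4 in auto)
      then show ?thesis using k True by simp
    qed
  next
    case False
    consider "card V = 1" | "card V = 6" "\<not> branching V E" | "card V \<noteq> 1" "card V \<noteq> 6 \<or> branching V E" by blast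
    then show ?thesis
    proof cases
      case 1
      then have "q = 0" "r = 0" using less.prems by auto
      moreover obtain v where v: "V = {v}" using 1 by (auto simp: card_1_singleton_iff)
      moreover have "E = {}" 
        using built_card[OF less.prems(1)] 1 simple_graph_finite_edges[OF built_simple[OF less.prems(1)]] by simp
      ultimately show ?thesis unfolding balanced_def
        by (intro exI[of _ "\<lambda>_. k0"] exI[of _ "{k0}"] exI[of _ "{}"]) (auto simp: fV_def fE_def)
    next
      case 2
      then obtain n where n: "path_graph n V E" using path_or_branching[OF less.prems(1)] by blast
      then have "n = 5" using 2 enum_tree_card by (fastforce simp: path_graph_def)
      moreover have "q = 1 \<and> r = 1" using less.prems(3,4) 2 False by presburger
      ultimately show ?thesis using n balanced_path6 by simp
    next
      case 3
      have "\<exists>V' E' u v. built V' E' \<and> (card V' \<in> {4, 5} \<longrightarrow> branching V' E') \<and>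
        u \<in> V' \<and> v \<notin> V' \<and> V = insert v V' \<and> E = insert {u, v} E'"
      proof (cases "branching V E")
        case True
        \<comment> \<open>Four vertices would mean \<open>r = 3\<close>. So \<open>V\<close> is more
          than the star, and a leaf can be removed that leaves the tree branching.\<close>
        have "card V \<noteq> 4" using less.prems(3) False \<open>r \<noteq> 3\<close> less.prems(4) by presburger
        then show ?thesis using branching_remove_leaf[OF True] branching_built by metis
      next
        case nb: False
        obtain V' E' u v where *: "built V' E'" "u \<in> V'" "v \<notin> V'" "V = insert v V'" "E = insert {u, v} E'"
          using built_remove_leaf[OF less.prems(1) 3(1)] by metis
        have "card V = Suc (card V')"
          using * by (simp add: simple_graph_finite[OF built_simple[OF *(1)]])
        \<comment> \<open>A remainder of four vertices would come from a non-branching tree on five,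
          which the hypothesis excludes; a remainder of five would come from six vertices, which is
          the previous case.\<close>
        then have "card V' \<notin> {4, 5}" using 3 nb less.prems(2) by auto
        then show ?thesis using * by blast
      qed
      then obtain V' E' u v where *: "built V' E'" "card V' \<in> {4, 5} \<Longrightarrow> branching V' E'"
        "u \<in> V'" "v \<notin> V'" "V = insert v V'" "E = insert {u, v} E'" by blast
      have s: "simple_graph V' E'" using *(1) by (rule built_simple)
      have c: "card V = Suc (card V')" using * simple_graph_finite[OF s] by simp
      show ?thesis
      proof (cases r)
        case 0
        then obtain k where k: "q = Suc k" using less.prems(3) 3 by (cases q) auto
        then have "balanced k 3 V' E'" using c less.prems 0 by (intro less.hyps *) auto
        then show ?thesis using balanced_leaf_wrap[OF _ s *(4,3)] k 0 * by simp
      next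
        case (Suc m)
        then have "balanced q m V' E'" using c less.prems by (intro less.hyps *) auto
        then show ?thesis using balanced_leaf[OF _ _ s *(4,3)] Suc False less.prems(4) * by simp
      qed
    qed
  qed
qed

section \<open>The exceptional paths and the characterization\<close>

lemma near_equalI:
  assumes "\<forall>a1 a2. \<bar>int (c a1) - int (c a2)\<bar> \<le> 1" "\<And>a. c a = count_list xs a"
  shows "near_equal xs"
proof -
  have "c a \<le> Suc (c b)" for a b using assms(1)[rule_format, of a b] by linarith
  then show ?thesis using assms(2) by (simp add: near_equal_def list_all_iff)
qed

lemma path4_not_cordial:
  assumes "path_graph 3 V E"
  shows "\<not> cordial TYPE(klein4) V E"
proof
  assume "cordial TYPE(klein4) V E"
  then obtain l :: "'a \<Rightarrow> klein4" where l: "cordial_labeling V E l" unfolding cordial_def by blast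
  obtain f where f: "enum_tree 3 f (\<lambda>i. i) V E" using assms by (auto simp: path_graph_def)
  note counts = enum_tree_counts[OF f, of l]
  have "near_equal [l (f 0), l (f 1), l (f 2), l (f 3)]"
    by (rule near_equalI[OF l[unfolded cordial_labeling_def, THEN conjunct1]])
      (simp add: counts count_list_Cons eval_nat_numeral ac_simps del: count_list.simps(2))
  moreover have "near_equal [l (f 1) + l (f 0), l (f 2) + l (f 1), l (f 3) + l (f 2)]"
    by (rule near_equalI[OF l[unfolded cordial_labeling_def, THEN conjunct2]])
      (simp add: counts count_list_Cons eval_nat_numeral ac_simps del: count_list.simps(2))
  ultimately show False using path4_table unfolding list_all_iff set_klein4_list by blast
qed

lemma path5_not_cordial:
  assumes "path_graph 4 V E"
  shows "\<not> cordial TYPE(klein4) V E"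
proof
  assume "cordial TYPE(klein4) V E"
  then obtain l :: "'a \<Rightarrow> klein4" where l: "cordial_labeling V E l" unfolding cordial_def by blast
  obtain f where f: "enum_tree 4 f (\<lambda>i. i) V E" using assms by (auto simp: path_graph_def)
  note counts = enum_tree_counts[OF f, of l]
  have "near_equal [l (f 0), l (f 1), l (f 2), l (f 3), l (f 4)]"
    by (rule near_equalI[OF l[unfolded cordial_labeling_def, THEN conjunct1]])
      (simp add: counts count_list_Cons eval_nat_numeral ac_simps del: count_list.simps(2))
  moreover have "near_equal [l (f 1) + l (f 0), l (f 2) + l (f 1), l (f 3) + l (f 2), l (f 4) + l (f 3)]"
    by (rule near_equalI[OF l[unfolded cordial_labeling_def, THEN conjunct2]])
      (simp add: counts count_list_Cons eval_nat_numeral ac_simps del: count_list.simps(2))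
  ultimately show False using path5_table unfolding list_all_iff set_klein4_list by blast
qed

theorem theorem6p1:
  fixes V :: "'a set" and E :: "'a set set"
  assumes "is_tree V E"
  shows "cordial TYPE(klein4) V E \<longleftrightarrow>
           \<not> graph_iso V E (path_V 4) (path_E 4) \<and> \<not> graph_iso V E (path_V 5) (path_E 5)"
proof
  assume c: "cordial TYPE(klein4) V E"
  have s: "simple_graph V E" using assms by (simp add: is_tree_def)
  show "\<not> graph_iso V E (path_V 4) (path_E 4) \<and> \<not> graph_iso V E (path_V 5) (path_E 5)"
    using c path4_not_cordial path5_not_cordial graph_iso_path[OF s, of 3] graph_iso_path[OF s, of 4] by auto
next
  assume not_path: "\<not> graph_iso V E (path_V 4) (path_E 4) \<and> \<not> graph_iso V E (path_V 5) (path_E 5)"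
  have b: "built V E" using assms by (rule tree_built)
  have "branching V E" if "card V \<in> {4, 5}"
  proof (rule ccontr)
    assume "\<not> branching V E"
    then obtain n where n: "path_graph n V E" using path_or_branching[OF b] by blast
    then have "Suc n = card V" using enum_tree_card by (fastforce simp: path_graph_def)
    then show False using path_graph_iso[OF n] not_path that by auto
  qed
  \<comment> \<open>The division is applied to the number of edges, because \<open>r\<close> ranges
    from 0 to 3 in \<open>4 * q + r + 1\<close>.\<close>
  moreover have "card V = 4 * ((card V - 1) div 4) + (card V - 1) mod 4 + 1"
    using built_card[OF b] by simp
  ultimately have "balanced ((card V - 1) div 4) ((card V - 1) mod 4) V E"
    using b by (intro built_balanced) auto
  then show "cordial TYPE(klein4) V E" by (rule balanced_cordial)
qed

end
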